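(* Every complete (that is, divisible) Abelian group is a complete algebra (closed to simple extensions) in the variety of Abelian groups.
   Context: Let $\mathbf{M}$ be the variety of Abelian groups. An Abelian group $G$ is called complete (divisible) if for every $a\in G$ and every integer $n\ge 1$ there is $x\in G$ with $x^n=a$ (multiplicative notation). The notion "complete algebra (closed to simple extensions)" is the following; all algebras below belong to $\mathbf{M}$, and $A\le B$ means that $A$ is a subalgebra of $B$. For a set $S$, $W(S)$ is the free algebra in $\mathbf{M}$ on $S$; its elements are classes $[w]$ of words (terms) $w$ over $S$. The underlying set of an algebra is used as a set of free generators without its operations, and $W(A)$ is regarded as a subalgebra of $W(A\cup\{a\})$. An algebra $A'\in\mathbf{M}$ is a simple extension of $A$ with element $a$ (possibly $a\in A$), written $A'=A\sqcup a$, if $A\le A'$ and $A\cup\{a\}$ generates $A'$. $Val_A:W(A)\to A$ and $Val_{A\sqcup a}:W(A\cup\{a\})\to A\sqcup a$ are the surjective homomorphisms extending the identity maps on $A$ and on $A\cup\{a\}$ respectively; $Ker_A$ and $Ker_{A\sqcup a}$ are their kernel congruences. The set of $a$-extension conditions for $A$ (given by $A\sqcup a$) is $Ker_{A\sqcup a}|_a := Ker_{A\sqcup a}\setminus Ker_A$. If $B\le B_1$ and $B\sqcup x$ is a simple extension of $B$, an element $b\in B_1$ satisfies the $x$-extension conditions $Ker_{B\sqcup x}|_x$ if $w(b)=w'(b)$ in $B_1$ for every $([w(x)],[w'(x)])\in Ker_{B\sqcup x}|_x$, where $w(b)$ is the value in $B_1$ of the word $w$ when each letter from $B$ is interpreted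 as itself and $x$ is interpreted as $b$. $B_1\in\mathbf{M}$ is a complete algebra (closed to simple extensions) in $\mathbf{M}$ if for each subalgebra $B\le B_1$ and each set of $x$-extension conditions $Ker_{B\sqcup x}|_x$ for $B$ (that is, for each simple extension $B\sqcup x\in\mathbf{M}$) there is $b\in B_1$ satisfying these conditions. *)

theory Defs
  imports "HOL-Algebra.Free_Abelian_Groups"
begin

text \<open>
  The variety of Abelian groups is \<^const>\<open>comm_group\<close>, and the free algebra \<open>W(S)\<close> is
  \<^const>\<open>free_Abelian_group\<close> \<open>S\<close>: the class of a word over \<open>S\<close> is the finitely supported
  family of the exponents of its letters.  With this representation the carrier of
  \<open>W(S)\<close> is a subset of the carrier of \<open>W(T)\<close> whenever \<open>S \<subseteq> T\<close>.
\<close>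

definition divisible_group :: "('a, 'm) monoid_scheme \<Rightarrow> bool" where
  "divisible_group G \<longleftrightarrow>
     (\<forall>a \<in> carrier G. \<forall>n::nat. n \<ge> 1 \<longrightarrow> (\<exists>x \<in> carrier G. x [^]\<^bsub>G\<^esub> n = a))"

text \<open>
  The value in \<open>G\<close> of (the class of) a word when each letter \<open>s\<close> is interpreted as \<open>f s\<close>.
  By \<open>word_val_hom\<close>, \<open>word_val_frag_of\<close> and \<open>word_val_unique\<close> below this is the unique
  homomorphism on the free group that extends \<open>f\<close>.
\<close>

definition word_val :: "('a, 'm) monoid_scheme \<Rightarrow> ('s \<Rightarrow> 'a) \<Rightarrow> ('s \<Rightarrow>\<^sub>0 int) \<Rightarrow> 'a" where
  "word_val G f w = (\<Otimes>\<^bsub>G\<^esub>s \<in> Poly_Mapping.keys w. f s [^]\<^bsub>G\<^esub> Poly_Mapping.lookup w s)"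

lemma (in comm_group) word_val_superset:
  assumes "finite T" "Poly_Mapping.keys w \<subseteq> T" "f ` T \<subseteq> carrier G"
  shows "word_val G f w = (\<Otimes>s \<in> T. f s [^] Poly_Mapping.lookup w s)"
  unfolding word_val_def
  by (rule finprod_mono_neutral_cong_left) (use assms in \<open>auto simp: in_keys_iff\<close>)

lemma (in comm_group) word_val_hom:
  assumes "f ` S \<subseteq> carrier G"
  shows "word_val G f \<in> hom (free_Abelian_group S) G"
proof (rule homI)
  fix v w
  assume vw: "v \<in> carrier (free_Abelian_group S)" "w \<in> carrier (free_Abelian_group S)"
  let ?T = "Poly_Mapping.keys v \<union> Poly_Mapping.keys w"
  have T: "finite ?T" "f ` ?T \<subseteq> carrier G" "Poly_Mapping.keys (v + w) \<subseteq> ?T"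
    using vw assms keys_add[of v w] by auto
  have "word_val G f (v + w) = (\<Otimes>s \<in> ?T. f s [^] Poly_Mapping.lookup (v + w) s)"
    using T by (intro word_val_superset)
  also have "\<dots> = (\<Otimes>s \<in> ?T. f s [^] Poly_Mapping.lookup v s \<otimes> f s [^] Poly_Mapping.lookup w s)"
    using T by (intro finprod_cong') (auto simp: lookup_add int_pow_mult)
  also have "\<dots> = (\<Otimes>s \<in> ?T. f s [^] Poly_Mapping.lookup v s) \<otimes>
                  (\<Otimes>s \<in> ?T. f s [^] Poly_Mapping.lookup w s)"
    using T by (intro finprod_multf) auto
  also have "\<dots> = word_val G f v \<otimes> word_val G f w"
    using T word_val_superset[of ?T v f] word_val_superset[of ?T w f] by simp
  finally show "word_val G f (v \<otimes>\<^bsub>free_Abelian_group S\<^esub> w) = word_val G f v \<otimes> word_val G f w"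
    by simp
qed (use assms in \<open>auto simp: word_val_def intro!: finprod_closed\<close>)

lemma (in comm_group) word_val_frag_of:
  assumes "f s \<in> carrier G"
  shows "word_val G f (frag_of s) = f s"
  using assms word_val_superset[of "{s}" "frag_of s" f] by simp

lemma (in comm_group) word_val_unique:
  assumes "f ` S \<subseteq> carrier G" "h \<in> hom (free_Abelian_group S) G"
    "\<And>s. s \<in> S \<Longrightarrow> h (frag_of s) = f s" "w \<in> carrier (free_Abelian_group S)"
  shows "h w = word_val G f w"
proof -
  have W: "group_hom (free_Abelian_group S) G (word_val G f)" "group_hom (free_Abelian_group S) G h"
    using word_val_hom[OF assms(1)] assms(2)
    by (simp_all add: group_hom_def group_hom_axioms_def)
  have "Poly_Mapping.keys w \<subseteq> S" using assms(4) by simp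
  then have "Poly_Mapping.keys w \<subseteq> S \<and> h w = word_val G f w"
  proof (induction rule: frag_induction)
    case zero
    show ?case using group_hom.hom_one[OF W(1)] group_hom.hom_one[OF W(2)] by simp
  next
    case (one s)
    then show ?case using assms(1,3) word_val_frag_of[of f s] by auto
  next
    case (diff a b)
    have D: "k (a - b) = k a \<otimes> inv (k b)" if "group_hom (free_Abelian_group S) G k" for k
      using group_hom.hom_mult[OF that, of a "- b"] group_hom.hom_inv[OF that, of b] diff by simp
    show ?case using D[OF W(1)] D[OF W(2)] diff keys_diff[of a b] by auto
  qed
  then show ?thesis ..
qed

text \<open>
  \<open>simple_extension E A a\<close>: the group \<open>E\<close> is \<open>A \<squnion> a\<close>.  A subalgebra is given by its underlying
  set; the algebra \<open>A\<close> itself is \<open>E\<lparr>carrier := A\<rparr>\<close>.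
\<close>

definition simple_extension :: "('e, 'm) monoid_scheme \<Rightarrow> 'e set \<Rightarrow> 'e \<Rightarrow> bool" where
  "simple_extension E A a \<longleftrightarrow>
     comm_group E \<and> subgroup A E \<and> a \<in> carrier E \<and> generate E (A \<union> {a}) = carrier E"

text \<open>The kernel congruence on \<open>W(S)\<close> of the homomorphism to \<open>G\<close> extending the identity on \<open>S\<close>.\<close>

definition Ker :: "('e, 'm) monoid_scheme \<Rightarrow> 'e set \<Rightarrow> (('e \<Rightarrow>\<^sub>0 int) \<times> ('e \<Rightarrow>\<^sub>0 int)) set" where
  "Ker G S = {(w, w'). w \<in> carrier (free_Abelian_group S) \<and> w' \<in> carrier (free_Abelian_group S) \<and>
                       word_val G (\<lambda>s. s) w = word_val G (\<lambda>s. s) w'}"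

definition extension_conditions ::
    "('e, 'm) monoid_scheme \<Rightarrow> 'e set \<Rightarrow> 'e \<Rightarrow> (('e \<Rightarrow>\<^sub>0 int) \<times> ('e \<Rightarrow>\<^sub>0 int)) set" where
  "extension_conditions E A a = Ker E (A \<union> {a}) - Ker (E\<lparr>carrier := A\<rparr>) A"

text \<open>
  Letters other than \<open>x\<close> are interpreted in \<open>B1\<close> through \<open>j\<close>, the letter \<open>x\<close> as \<open>b\<close>.
\<close>

definition satisfies_conditions ::
    "('a, 'm) monoid_scheme \<Rightarrow> ('e \<Rightarrow> 'a) \<Rightarrow> 'e \<Rightarrow> (('e \<Rightarrow>\<^sub>0 int) \<times> ('e \<Rightarrow>\<^sub>0 int)) set \<Rightarrow> 'a \<Rightarrow> bool" where
  "satisfies_conditions B1 j x C b \<longleftrightarrow>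
     (\<forall>(w, w') \<in> C. word_val B1 (j(x := b)) w = word_val B1 (j(x := b)) w')"

text \<open>
  A simple extension of a subgroup \<open>B\<close> need not fit into the type \<open>'a\<close> of the elements of \<open>B1\<close>
  (which may, for instance, be exhausted by \<open>B\<close>).  The extensions are therefore taken over a further
  type \<open>'e\<close>, and they extend a subgroup \<open>A\<close> that is identified with \<open>B\<close> by an isomorphism \<open>j\<close>.
  For \<open>'e = 'a\<close>, \<open>A = B\<close> and \<open>j\<close> the identity these are the extensions literally containing \<open>B\<close>.
  Being complete without reference to a type means being complete for every \<open>'e\<close>.
\<close>

definition complete_algebra :: "'e itself \<Rightarrow> ('a, 'm) monoid_scheme \<Rightarrow> bool" where
  "complete_algebra (_ :: 'e itself) B1 \<longleftrightarrow>
     comm_group B1 \<and>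
     (\<forall>B. subgroup B B1 \<longrightarrow>
        (\<forall>(E :: 'e monoid) A x j.
           simple_extension E A x \<and> j \<in> iso (E\<lparr>carrier := A\<rparr>) (B1\<lparr>carrier := B\<rparr>) \<longrightarrow>
           (\<exists>b \<in> carrier B1. satisfies_conditions B1 j x (extension_conditions E A x) b)))"

end

theory Submission
  imports Defs
begin

text \<open>
  The integers \<open>n\<close> with \<open>x\<^sup>n \<in> A\<close> are the multiples of some \<open>d\<close>. Divisibility provides \<open>b\<close> with
  \<open>b\<^sup>d = j (x\<^sup>d)\<close>, and then \<open>a x\<^sup>n \<mapsto> j a b\<^sup>n\<close> is a well-defined homomorphism on \<open>A \<squnion> x\<close>,
  so \<open>b\<close> satisfies every equation that \<open>x\<close> satisfies.
\<close>

text \<open>The exponents \<open>n\<close> with \<open>x [^] n \<in> A\<close> form a subgroup of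
  the integers, so they are the multiples of one \<open>d\<close>. The value \<open>d = 0\<close> is
  allowed and means that only the zeroth power of \<open>x\<close> lies in \<open>A\<close>.\<close>

lemma (in group) int_pow_mem_subgroup_generator:
  assumes "subgroup A G" "x \<in> carrier G"
  obtains d :: nat where "x [^] d \<in> A" "\<And>n::int. x [^] n \<in> A \<Longrightarrow> int d dvd n"
proof (cases "\<exists>k::nat. k > 0 \<and> x [^] k \<in> A")
  case True
  define d where "d = (LEAST k::nat. k > 0 \<and> x [^] k \<in> A)"
  have d: "d > 0" "x [^] d \<in> A"
    using LeastI_ex[OF True] by (simp_all add: d_def)
  have "int d dvd n" if n: "x [^] n \<in> A" for n :: int
  proof -
    \<comment> \<open>Division with remainder: the power of \<open>x\<close> to the remainder is a
      product of \<open>x [^] n\<close> and a power of \<open>x [^] d\<close>, so it lies in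
      \<open>A\<close>, and minimality of \<open>d\<close> leaves only remainder 0.\<close>
    have "n mod int d = n + int d * (- (n div int d))"
      by (simp add: minus_mult_div_eq_mod)
    then have "x [^] (n mod int d) = x [^] n \<otimes> (x [^] d) [^] (- (n div int d))"
      using assms(2) by (simp only: int_pow_mult int_pow_pow[symmetric] int_pow_int)
    also have "\<dots> \<in> A"
      using subgroup.m_closed[OF assms(1) n] subgroup_int_pow_closed[OF assms(1) d(2)] by blast
    finally have "x [^] nat (n mod int d) \<in> A"
      using d(1) by (simp add: int_pow_int[symmetric])
    moreover have "nat (n mod int d) < d"
      using d(1) by (simp add: nat_less_iff)
    ultimately have "nat (n mod int d) = 0"
      using not_less_Least[of "nat (n mod int d)" "\<lambda>k. k > 0 \<and> x [^] k \<in> A"]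
      by (auto simp: d_def[symmetric])
    moreover have "n mod int d \<ge> 0"
      using d(1) by simp
    ultimately show ?thesis
      by (simp add: dvd_eq_mod_eq_0)
  qed
  with d(2) show ?thesis by (rule that)
next
  case False
  have "n = 0" if n: "x [^] n \<in> A" for n :: int
  proof (rule ccontr)
    assume "n \<noteq> 0"
    have "x [^] (- n) \<in> A"
      using subgroup.m_inv_closed[OF assms(1) n] assms(2) by (simp add: int_pow_neg)
    \<comment> \<open>Closure under inverses makes the exponent positive, as the case assumption
      speaks of positive natural exponents only.\<close>
    with n have "x [^] \<bar>n\<bar> \<in> A"
      by (simp add: abs_if)
    then have "x [^] nat \<bar>n\<bar> \<in> A"
      by (metis int_pow_int nat_0_le abs_ge_zero)
    moreover have "nat \<bar>n\<bar> > 0"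
      using \<open>n \<noteq> 0\<close> by simp
    ultimately show False
      using False by blast
  qed
  then show ?thesis
    using subgroup.one_closed[OF assms(1)] by (intro that[of 0]) auto
qed

theorem proposition5:
  fixes G :: "('a, 'm) monoid_scheme"
  assumes "comm_group G"
    and "divisible_group G"
  shows "complete_algebra TYPE('e) G"
  unfolding complete_algebra_def
proof (intro conjI allI impI)
  show "comm_group G" by fact
next
  fix B and E :: "'e monoid" and A x j
  assume B: "subgroup B G"
  assume "simple_extension E A x \<and> j \<in> iso (E\<lparr>carrier := A\<rparr>) (G\<lparr>carrier := B\<rparr>)"
  then have E: "comm_group E" and A: "subgroup A E" and x: "x \<in> carrier E"
    and j: "j \<in> hom (E\<lparr>carrier := A\<rparr>) (G\<lparr>carrier := B\<rparr>)"
    by (auto simp: simple_extension_def iso_def)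
  interpret G: comm_group G by fact
  interpret E: comm_group E by fact
  have A_carr: "a \<in> carrier E" if "a \<in> A" for a
    using subgroup.mem_carrier[OF A that] .
  \<comment> \<open>The target is enlarged from \<open>B\<close> to \<open>G\<close>, because
    \<open>b\<close> may lie outside \<open>B\<close> and its powers are multiplied with values of
    \<open>j\<close>.\<close>
  interpret j: group_hom "E\<lparr>carrier := A\<rparr>" G j
  proof -
    have "j \<in> hom (E\<lparr>carrier := A\<rparr>) G"
      using j subgroup.subset[OF B] by (auto simp: hom_def)
    then show "group_hom (E\<lparr>carrier := A\<rparr>) G j"
      using subgroup.subgroup_is_group[OF A E.is_group] G.is_group
      by (simp add: group_hom_def group_hom_axioms_def)
  qed
  have j_carr: "j a \<in> carrier G" if "a \<in> A" for a
    using j.hom_closed that by simp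
  have j_mult: "j (a \<otimes>\<^bsub>E\<^esub> a') = j a \<otimes>\<^bsub>G\<^esub> j a'" if "a \<in> A" "a' \<in> A" for a a'
    using j.hom_mult that by simp
  have j_one: "j \<one>\<^bsub>E\<^esub> = \<one>\<^bsub>G\<^esub>"
    using j.hom_one by simp
  have j_inv: "j (inv\<^bsub>E\<^esub> a) = inv\<^bsub>G\<^esub> j a" if "a \<in> A" for a
    using j.hom_inv[of a] that E.m_inv_consistent[OF A that] by simp
  have j_pow: "j (a [^]\<^bsub>E\<^esub> n) = j a [^]\<^bsub>G\<^esub> n" if "a \<in> A" for a and n :: int
    using j.hom_int_pow[of a n] that E.int_pow_consistent[OF A that, of n]
    by simp
  obtain d :: nat where d: "x [^]\<^bsub>E\<^esub> d \<in> A" "\<And>n::int. x [^]\<^bsub>E\<^esub> n \<in> A \<Longrightarrow> int d dvd n"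
    using E.int_pow_mem_subgroup_generator[OF A x] by blast
  obtain b where b: "b \<in> carrier G" "b [^]\<^bsub>G\<^esub> d = j (x [^]\<^bsub>E\<^esub> d)"
  \<comment> \<open>Divisibility gives roots for exponents at least 1 only. For \<open>d = 0\<close>
    the equation reads \<open>\<one> = j \<one>\<close> and does not restrict \<open>b\<close>, so
    the unit is taken.\<close>
  proof (cases "d = 0")
    case True
    then show ?thesis using that[of "\<one>\<^bsub>G\<^esub>"] j_one by simp
  next
    case False
    then show ?thesis
      using assms(2) j_carr[OF d(1)] that unfolding divisible_group_def by (metis less_one not_le)
  qed
  \<comment> \<open>The agreement of \<open>j\<close> with the assignment of powers of
    \<open>b\<close> to powers of \<open>x\<close> wherever these fall into \<open>A\<close>;
    well-definedness rests on it.\<close>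
  have b_pow: "b [^]\<^bsub>G\<^esub> n = j (x [^]\<^bsub>E\<^esub> n)" if n: "x [^]\<^bsub>E\<^esub> n \<in> A" for n :: int
  proof -
    obtain k where k: "n = int d * k"
      using d(2)[OF n] by blast
    have "b [^]\<^bsub>G\<^esub> n = (b [^]\<^bsub>G\<^esub> d) [^]\<^bsub>G\<^esub> k"
      using b(1) by (simp only: k G.int_pow_pow[symmetric] int_pow_int)
    also have "\<dots> = j ((x [^]\<^bsub>E\<^esub> d) [^]\<^bsub>E\<^esub> k)"
      using d(1) by (simp only: b(2) j_pow)
    also have "\<dots> = j (x [^]\<^bsub>E\<^esub> n)"
      using x by (simp only: k E.int_pow_pow[symmetric] int_pow_int)
    finally show ?thesis .
  qed
  let ?f = "j(x := b)"
  have f: "?f ` (A \<union> {x}) \<subseteq> carrier G"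
    using b(1) j_carr by auto
  have i: "(\<lambda>s. s) ` (A \<union> {x}) \<subseteq> carrier E"
    using x A_carr by auto
  interpret VE: group_hom "free_Abelian_group (A \<union> {x})" E "word_val E (\<lambda>s. s)"
    using E.word_val_hom[OF i] by (simp add: group_hom_def group_hom_axioms_def)
  interpret VG: group_hom "free_Abelian_group (A \<union> {x})" G "word_val G ?f"
    using G.word_val_hom[OF f] by (simp add: group_hom_def group_hom_axioms_def)
  \<comment> \<open>The pair \<open>a\<close>, \<open>n\<close> need not be determined by the value
    in \<open>E\<close>. What matters is that one pair describes both values of the word, so no map
    on \<open>E\<close> has to be constructed.\<close>
  have normal_form: "\<exists>a \<in> A. \<exists>n::int. word_val E (\<lambda>s. s) w = a \<otimes>\<^bsub>E\<^esub> x [^]\<^bsub>E\<^esub> n \<and>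
      word_val G ?f w = j a \<otimes>\<^bsub>G\<^esub> b [^]\<^bsub>G\<^esub> n"
    if "Poly_Mapping.keys w \<subseteq> A \<union> {x}" for w
  proof -
    have "Poly_Mapping.keys w \<subseteq> A \<union> {x} \<and> (\<exists>a \<in> A. \<exists>n::int.
        word_val E (\<lambda>s. s) w = a \<otimes>\<^bsub>E\<^esub> x [^]\<^bsub>E\<^esub> n \<and> word_val G ?f w = j a \<otimes>\<^bsub>G\<^esub> b [^]\<^bsub>G\<^esub> n)"
      using that
    proof (induction rule: frag_induction)
      case zero
      show ?case
        using VE.hom_one VG.hom_one j_one subgroup.one_closed[OF A]
        by (auto intro!: bexI[of _ "\<one>\<^bsub>E\<^esub>"] exI[of _ 0] simp del: fun_upd_apply)
    next
      case (one s)
      then have s: "s \<in> carrier E" "?f s \<in> carrier G"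
        using i f by (blast, blast)
      have val: "word_val E (\<lambda>s. s) (frag_of s) = s" "word_val G ?f (frag_of s) = ?f s"
        using E.word_val_frag_of[of "\<lambda>s. s" s] G.word_val_frag_of[of ?f s] s by simp_all
      \<comment> \<open>The letter \<open>x\<close> is written as \<open>\<one>\<close> times its
        first power, any other letter as itself times the zeroth power. The split is on
        \<open>s = x\<close> and not on \<open>s \<in> A\<close>, since \<open>x\<close> may belong
        to \<open>A\<close> and \<open>?f\<close> sends it to \<open>b\<close> even then.\<close>
      show ?case
      proof (cases "s = x")
        case True
        then show ?thesis
          unfolding val using x b(1) j_one subgroup.one_closed[OF A]
          by (auto intro!: bexI[of _ "\<one>\<^bsub>E\<^esub>"] exI[of _ 1] simp: E.int_pow_1 G.int_pow_1)
      next
        case False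
        with one have "s \<in> A" by simp
        then show ?thesis
          unfolding val using False s
          by (auto intro!: bexI[of _ s] exI[of _ 0])
      qed
    next
      case (diff v w)
      then obtain a n a' n' where a: "a \<in> A" "a' \<in> A"
        and v: "word_val E (\<lambda>s. s) v = a \<otimes>\<^bsub>E\<^esub> x [^]\<^bsub>E\<^esub> (n::int)"
          "word_val G ?f v = j a \<otimes>\<^bsub>G\<^esub> b [^]\<^bsub>G\<^esub> n"
        and w: "word_val E (\<lambda>s. s) w = a' \<otimes>\<^bsub>E\<^esub> x [^]\<^bsub>E\<^esub> (n'::int)"
          "word_val G ?f w = j a' \<otimes>\<^bsub>G\<^esub> b [^]\<^bsub>G\<^esub> n'"
        by blast
      have keys: "Poly_Mapping.keys v \<subseteq> A \<union> {x}" "Poly_Mapping.keys w \<subseteq> A \<union> {x}"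
        using diff by auto
      note carr = A_carr[OF a(1)] A_carr[OF a(2)] j_carr[OF a(1)] j_carr[OF a(2)] x b(1)
      have "word_val E (\<lambda>s. s) (v - w) = word_val E (\<lambda>s. s) v \<otimes>\<^bsub>E\<^esub> inv\<^bsub>E\<^esub> word_val E (\<lambda>s. s) w"
        using VE.hom_mult[of v "- w"] VE.hom_inv[of w] keys by simp
      \<comment> \<open>Commutativity collects the factors from \<open>A\<close> and the powers of
        \<open>x\<close>; the same regrouping in \<open>G\<close> yields the matching pair.\<close>
      also have "\<dots> = (a \<otimes>\<^bsub>E\<^esub> inv\<^bsub>E\<^esub> a') \<otimes>\<^bsub>E\<^esub> x [^]\<^bsub>E\<^esub> (n - n')"
        using carr by (simp add: v w E.int_pow_diff E.inv_mult E.m_ac)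
      finally have 1: "word_val E (\<lambda>s. s) (v - w) = \<dots>" .
      have "word_val G ?f (v - w) = word_val G ?f v \<otimes>\<^bsub>G\<^esub> inv\<^bsub>G\<^esub> word_val G ?f w"
        using VG.hom_mult[of v "- w"] VG.hom_inv[of w] keys by simp
      also have "\<dots> = (j a \<otimes>\<^bsub>G\<^esub> inv\<^bsub>G\<^esub> j a') \<otimes>\<^bsub>G\<^esub> b [^]\<^bsub>G\<^esub> (n - n')"
        using carr by (simp add: v w G.int_pow_diff G.inv_mult G.m_ac)
      also have "j a \<otimes>\<^bsub>G\<^esub> inv\<^bsub>G\<^esub> j a' = j (a \<otimes>\<^bsub>E\<^esub> inv\<^bsub>E\<^esub> a')"
        using a subgroup.m_inv_closed[OF A] by (simp add: j_mult j_inv)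
      finally have 2: "word_val G ?f (v - w) = j (a \<otimes>\<^bsub>E\<^esub> inv\<^bsub>E\<^esub> a') \<otimes>\<^bsub>G\<^esub> b [^]\<^bsub>G\<^esub> (n - n')" .
      have "a \<otimes>\<^bsub>E\<^esub> inv\<^bsub>E\<^esub> a' \<in> A"
        using a subgroup.m_closed[OF A] subgroup.m_inv_closed[OF A] by blast
      with 1 2 keys keys_diff[of v w] show ?case by blast
    qed
    then show ?thesis ..
  qed
  have "word_val G ?f w = word_val G ?f w'" if ww': "(w, w') \<in> extension_conditions E A x" for w w'
  proof -
    have keys: "Poly_Mapping.keys w \<subseteq> A \<union> {x}" "Poly_Mapping.keys w' \<subseteq> A \<union> {x}"
      and eq: "word_val E (\<lambda>s. s) w = word_val E (\<lambda>s. s) w'"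
      using ww' by (auto simp: extension_conditions_def Ker_def)
    obtain a n where a: "a \<in> A" and w: "word_val E (\<lambda>s. s) w = a \<otimes>\<^bsub>E\<^esub> x [^]\<^bsub>E\<^esub> (n::int)"
        "word_val G ?f w = j a \<otimes>\<^bsub>G\<^esub> b [^]\<^bsub>G\<^esub> n"
      using normal_form[OF keys(1)] by blast
    obtain a' n' where a': "a' \<in> A" and w': "word_val E (\<lambda>s. s) w' = a' \<otimes>\<^bsub>E\<^esub> x [^]\<^bsub>E\<^esub> (n'::int)"
        "word_val G ?f w' = j a' \<otimes>\<^bsub>G\<^esub> b [^]\<^bsub>G\<^esub> n'"
      using normal_form[OF keys(2)] by blast
    note carr = A_carr[OF a] A_carr[OF a'] j_carr[OF a] j_carr[OF a'] x b(1)
    \<comment> \<open>Two normal forms of one element of \<open>E\<close> differ by a power of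
      \<open>x\<close> that lies in \<open>A\<close>, which is where \<open>b_pow\<close>
      applies.\<close>
    have "x [^]\<^bsub>E\<^esub> (n - n') = inv\<^bsub>E\<^esub> a \<otimes>\<^bsub>E\<^esub> (a \<otimes>\<^bsub>E\<^esub> x [^]\<^bsub>E\<^esub> n) \<otimes>\<^bsub>E\<^esub> inv\<^bsub>E\<^esub> (x [^]\<^bsub>E\<^esub> n')"
      using carr by (simp add: E.int_pow_diff E.m_assoc[symmetric])
    also have "\<dots> = inv\<^bsub>E\<^esub> a \<otimes>\<^bsub>E\<^esub> a'"
      using carr eq by (simp add: w w' E.m_assoc)
    finally have x_pow: "x [^]\<^bsub>E\<^esub> (n - n') = inv\<^bsub>E\<^esub> a \<otimes>\<^bsub>E\<^esub> a'" .
    moreover have "inv\<^bsub>E\<^esub> a \<otimes>\<^bsub>E\<^esub> a' \<in> A"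
      using a a' subgroup.m_closed[OF A] subgroup.m_inv_closed[OF A] by blast
    ultimately have "b [^]\<^bsub>G\<^esub> (n - n') = inv\<^bsub>G\<^esub> j a \<otimes>\<^bsub>G\<^esub> j a'"
      using b_pow[of "n - n'"] a a' subgroup.m_inv_closed[OF A] by (simp add: j_mult j_inv)
    \<comment> \<open>Multiplying by \<open>j a\<close> and by the power of \<open>b\<close> to
      \<open>n'\<close> turns the relation back into equality of the two values in
      \<open>G\<close>.\<close>
    then have "j a \<otimes>\<^bsub>G\<^esub> b [^]\<^bsub>G\<^esub> (n - n') \<otimes>\<^bsub>G\<^esub> b [^]\<^bsub>G\<^esub> n' = j a' \<otimes>\<^bsub>G\<^esub> b [^]\<^bsub>G\<^esub> n'"
      using carr by (simp add: G.m_assoc[symmetric])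
    moreover have "b [^]\<^bsub>G\<^esub> (n - n') \<otimes>\<^bsub>G\<^esub> b [^]\<^bsub>G\<^esub> n' = b [^]\<^bsub>G\<^esub> n"
      using b(1) by (simp add: G.int_pow_mult[symmetric])
    ultimately show ?thesis
      using carr by (simp add: w w' G.m_assoc)
  qed
  with b(1) show "\<exists>b \<in> carrier G. satisfies_conditions G j x (extension_conditions E A x) b"
    unfolding satisfies_conditions_def by blast
qed

end
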